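(* Every $(0,3,6)$-fullerene is isomorphic to a Cayley sum graph for an abelian group which can be generated by two elements.
   Context: A semiedge of a graph is an edge with one endpoint; it contributes one to the valency of its endpoint and one to the corresponding diagonal entry of the adjacency matrix, and in a plane embedding it sits in a face and contributes one to that face's length. A $(0,3,6)$-fullerene is a cubic plane graph, possibly with semiedges, whose faces have sizes 3 and 6. For a finite additive abelian group $\Gamma$ and a (multi)set $S \subseteq \Gamma$, the Cayley sum graph $\mathrm{Cay}^+(\Gamma,S)$ has vertex set $\Gamma$, with $uv$ an edge if and only if $u+v\in S$ (a multiset $S$ gives multiple edges, and if $2u\in S$ the edge $uu$ is a semiedge). *)

theory Defs
  imports "HOL-Algebra.Generated_Groups" "HOL-Combinatorics.Orbits" "HOL-Library.Multiset"
begin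

text \<open>
  A graph with semiedges is given by its vertices and its darts (half-edges). Each dart \<open>d\<close>
  starts at the vertex \<open>beg d\<close> and is reversed by \<open>opp\<close>. An edge is a set \<open>{d, opp d}\<close>; it is a
  semiedge if \<open>opp d = d\<close>, and otherwise an ordinary edge (a loop if both darts start at the same
  vertex). Multiple edges are allowed. A semiedge contributes one dart, hence one to the valency,
  and a loop contributes two.
\<close>

record ('v, 'd) sgraph =
  verts :: "'v set"
  darts :: "'d set"
  beg :: "'d \<Rightarrow> 'v"
  opp :: "'d \<Rightarrow> 'd"

definition sgraph :: "('v, 'd) sgraph \<Rightarrow> bool" where
  "sgraph G \<longleftrightarrow>
     finite (verts G) \<and> finite (darts G) \<and>
     (\<forall>d\<in>darts G. beg G d \<in> verts G \<and> opp G d \<in> darts G \<and> opp G (opp G d) = d)"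

definition darts_at :: "('v, 'd) sgraph \<Rightarrow> 'v \<Rightarrow> 'd set" where
  "darts_at G v = {d \<in> darts G. beg G d = v}"

definition cubic :: "('v, 'd) sgraph \<Rightarrow> bool" where
  "cubic G \<longleftrightarrow> (\<forall>v\<in>verts G. card (darts_at G v) = 3)"

definition adjacency :: "('v, 'd) sgraph \<Rightarrow> 'v rel" where
  "adjacency G = {(beg G d, beg G (opp G d)) | d. d \<in> darts G}"

definition connected_sgraph :: "('v, 'd) sgraph \<Rightarrow> bool" where
  "connected_sgraph G \<longleftrightarrow>
     verts G \<noteq> {} \<and> (\<forall>u\<in>verts G. \<forall>v\<in>verts G. (u, v) \<in> (adjacency G)\<^sup>*)"

definition proper_edges :: "('v, 'd) sgraph \<Rightarrow> 'd set set" where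
  "proper_edges G = {{d, opp G d} | d. d \<in> darts G \<and> opp G d \<noteq> d}"

definition sgraph_iso :: "('v, 'd) sgraph \<Rightarrow> ('w, 'e) sgraph \<Rightarrow> bool" where
  "sgraph_iso G H \<longleftrightarrow>
     (\<exists>f g. bij_betw f (verts G) (verts H) \<and> bij_betw g (darts G) (darts H) \<and>
        (\<forall>d\<in>darts G. beg H (g d) = f (beg G d) \<and> opp H (g d) = g (opp G d)))"

text \<open>
  An embedding in an oriented surface is given by a rotation system: a permutation of the darts
  that cyclically permutes the darts at each vertex. (This presupposes that there are no isolated
  vertices.)
\<close>

definition rotation_system :: "('v, 'd) sgraph \<Rightarrow> ('d \<Rightarrow> 'd) \<Rightarrow> bool" where
  "rotation_system G rot \<longleftrightarrow>
     rot permutes darts G \<and> (\<forall>v\<in>verts G. cyclic_on rot (darts_at G v))"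

text \<open>
  A face is given by the darts on its boundary walk: traverse a dart, then continue with the next
  dart in the rotation at its end. At a semiedge the walk returns to the same vertex, so a semiedge
  contributes one to the size of the face containing it. The size of a face is its cardinality.
\<close>

definition faces :: "('v, 'd) sgraph \<Rightarrow> ('d \<Rightarrow> 'd) \<Rightarrow> 'd set set" where
  "faces G rot = {orbit (\<lambda>e. rot (opp G e)) d | d. d \<in> darts G}"

text \<open>
  The surface of a connected embedded graph is a sphere iff Euler's formula holds.
  A semiedge is an arc with a free end inside a face, so it does not affect the Euler
  characteristic and only proper edges are counted.
\<close>

definition plane_sgraph :: "('v, 'd) sgraph \<Rightarrow> ('d \<Rightarrow> 'd) \<Rightarrow> bool" where
  "plane_sgraph G rot \<longleftrightarrow>
     sgraph G \<and> connected_sgraph G \<and> rotation_system G rot \<and>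
     int (card (verts G)) - int (card (proper_edges G)) + int (card (faces G rot)) = 2"

definition fullerene_036 :: "('v, 'd) sgraph \<Rightarrow> ('d \<Rightarrow> 'd) \<Rightarrow> bool" where
  "fullerene_036 G rot \<longleftrightarrow>
     plane_sgraph G rot \<and> cubic G \<and> (\<forall>F\<in>faces G rot. card F = 3 \<or> card F = 6)"

text \<open>
  The darts \<open>(u, v, i)\<close> and \<open>(v, u, i)\<close> form the \<open>i\<close>-th edge between \<open>u\<close> and \<open>v\<close>; for \<open>u = v\<close> they
  coincide and form a semiedge. The group operation is written multiplicatively.
\<close>

definition cayley_sum_graph ::
    "('a, 'b) monoid_scheme \<Rightarrow> 'a multiset \<Rightarrow> ('a, 'a \<times> 'a \<times> nat) sgraph" where
  "cayley_sum_graph \<Gamma> S =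
     \<lparr> verts = carrier \<Gamma>,
       darts = {(u, v, i). u \<in> carrier \<Gamma> \<and> v \<in> carrier \<Gamma> \<and> i < count S (u \<otimes>\<^bsub>\<Gamma>\<^esub> v)},
       beg = (\<lambda>(u, v, i). u),
       opp = (\<lambda>(u, v, i). (v, u, i)) \<rparr>"

end

theory Submission
  imports Defs
begin

text \<open>
  Let \<open>\<alpha>\<close> reverse darts and let \<open>\<rho>\<close> be the rotation. Since \<open>\<alpha>\<^sup>2 = \<rho>\<^sup>3 = (\<rho>\<alpha>)\<^sup>6 = 1\<close>, the darts carry an
  action of the rotation group of the hexagonal tiling. The half-turns \<open>p\<^sub>i = \<rho>\<^sup>-\<^sup>i \<alpha> \<rho>\<^sup>i\<close> satisfy
  \<open>(p\<^sub>0 p\<^sub>1 p\<^sub>2)\<^sup>2 = 1\<close>, so \<open>p\<^sub>0 p\<^sub>1\<close> and \<open>p\<^sub>1 p\<^sub>2\<close> commute and generate an abelian group \<open>T\<close> of translations,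
  which every \<open>p\<^sub>i\<close> inverts by conjugation.

  Euler's formula is needed only to find a dart \<open>d\<^sub>0\<close> fixed by \<open>\<alpha>\<close> or by \<open>(\<rho>\<alpha>)\<^sup>3\<close>, that is, a semiedge or
  a triangle. Then the orbit \<open>T d\<^sub>0\<close> is closed under the \<open>p\<^sub>i\<close>, and by connectedness its images under
  \<open>1, \<rho>, \<rho>\<^sup>2\<close> cover all darts. These images are disjoint because there are no faces of size 1 or 2 and
  \<open>\<rho>\<close> has no fixed darts. So the vertices correspond to \<open>T d\<^sub>0\<close>, a regular orbit of a
  quotient \<open>\<Gamma>\<close> of \<open>T\<close>. Writing \<open>p\<^sub>i d\<^sub>0 = s\<^sub>i d\<^sub>0\<close> with \<open>s\<^sub>i\<close> in \<open>T\<close>, the dart \<open>\<rho>\<^sup>i t d\<^sub>0\<close> leads from the vertex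
  of \<open>t\<close> to the vertex of \<open>t\<^sup>-\<^sup>1 s\<^sub>i\<close>, and its reverse again has index \<open>i\<close>. Hence the graph is the Cayley
  sum graph of \<open>\<Gamma>\<close> for the multiset of the three \<open>s\<^sub>i\<close>.
\<close>

section \<open>Actions of the integers and of their square\<close>

text \<open>The inverse \<open>f'\<close> is a parameter, so integer powers reduce to natural ones
  and no inverse function has to be formed.\<close>

definition iterate :: "('a \<Rightarrow> 'a) \<Rightarrow> ('a \<Rightarrow> 'a) \<Rightarrow> int \<Rightarrow> 'a \<Rightarrow> 'a" where
  "iterate f f' k = (if 0 \<le> k then f ^^ nat k else f' ^^ nat (- k))"

lemma iterate_0 [simp]: "iterate f f' 0 x = x"
  by (simp add: iterate_def)

lemma iterate_1 [simp]: "iterate f f' 1 x = f x"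
  by (simp add: iterate_def)

lemma iterate_uminus_1 [simp]: "iterate f f' (- 1) x = f' x"
  by (simp add: iterate_def)

lemma iterate_plus_one:
  assumes "\<And>x. f (f' x) = x"
  shows "iterate f f' (k + 1) x = f (iterate f f' k x)"
proof (cases "0 \<le> k")
  case True
  then have "nat (k + 1) = Suc (nat k)" by simp
  with True show ?thesis by (simp add: iterate_def)
next
  case False
  then have "nat (- k) = Suc (nat (- (k + 1)))" by simp
  with False assms show ?thesis by (auto simp: iterate_def)
qed

lemma iterate_minus_one:
  assumes "\<And>x. f (f' x) = x" "\<And>x. f' (f x) = x"
  shows "iterate f f' (k - 1) x = f' (iterate f f' k x)"
  using iterate_plus_one[of f f' "k - 1" x] assms by simp

lemma iterate_add:
  assumes "\<And>x. f (f' x) = x" "\<And>x. f' (f x) = x"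
  shows "iterate f f' (k + l) x = iterate f f' k (iterate f f' l x)"
proof (induction k rule: int_induct[where k = 0])
  case (step1 i)
  then show ?case
    using iterate_plus_one[of f f' "i + l" x] iterate_plus_one[of f f' i] assms
    by (simp add: algebra_simps)
next
  case (step2 i)
  then show ?case
    using iterate_minus_one[of f f' "i + l" x] iterate_minus_one[of f f' i] assms
    by (simp add: algebra_simps)
qed simp

text \<open>Intertwining \<open>f\<close> with \<open>h\<close> forces intertwining of
  \<open>f'\<close> with \<open>h'\<close>, so the induction can run through the integers in both
  directions.\<close>

lemma iterate_intertwine:
  assumes "\<And>x. f (f' x) = x" "\<And>x. f' (f x) = x" "\<And>x. h (h' x) = x" "\<And>x. h' (h x) = x"
    and "\<And>x. F (f x) = h (F x)"
  shows "F (iterate f f' k x) = iterate h h' k (F x)"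
proof (induction k rule: int_induct[where k = 0])
  case (step1 i)
  then show ?case using assms by (simp add: iterate_plus_one)
next
  case (step2 i)
  have "F (f' y) = h' (F y)" for y using assms by metis
  with step2 show ?case using assms by (simp add: iterate_minus_one)
qed simp

locale commuting_bijections =
  fixes f f' g g' :: "'a \<Rightarrow> 'a"
  assumes ff' [simp]: "f (f' x) = x" and f'f [simp]: "f' (f x) = x"
    and gg' [simp]: "g (g' x) = x" and g'g [simp]: "g' (g x) = x"
    and comm: "f (g x) = g (f x)"
begin

definition act :: "int \<Rightarrow> int \<Rightarrow> 'a \<Rightarrow> 'a" where
  "act m n x = iterate f f' m (iterate g g' n x)"

lemma iterate_comm: "iterate f f' m (iterate g g' n x) = iterate g g' n (iterate f f' m x)"
proof -
  have "f (iterate g g' n x) = iterate g g' n (f x)" for x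
    by (rule iterate_intertwine) (simp_all add: comm)
  then show ?thesis
    using iterate_intertwine[of f f' f f' "iterate g g' n" m x] by simp
qed

lemma act_0 [simp]: "act 0 0 x = x"
  by (simp add: act_def)

lemma act_add: "act (m + m') (n + n') x = act m n (act m' n' x)"
  by (simp add: act_def iterate_add iterate_comm)

lemma act_simps:
  "act 1 0 x = f x" "act (- 1) 0 x = f' x" "act 0 1 x = g x" "act 0 (- 1) x = g' x"
  by (simp_all add: act_def)

lemma act_uminus [simp]:
  "act m n (act (- m) (- n) x) = x" "act (- m) (- n) (act m n x) = x"
  by (simp_all flip: act_add)

lemma act_commute: "act m n (act m' n' x) = act m' n' (act m n x)"
  by (simp flip: act_add add: add.commute)

lemma iterate_act: "iterate (act c d) (act (- c) (- d)) k x = act (k * c) (k * d) x"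
proof (induction k rule: int_induct[where k = 0])
  case (step1 i)
  then show ?case
    using act_add[of c "i * c" d "i * d" x] iterate_plus_one[of "act c d" "act (- c) (- d)" i]
    by (simp add: algebra_simps)
next
  case (step2 i)
  then show ?case
    using act_add[of "- c" "i * c" "- d" "i * d" x]
      iterate_minus_one[of "act c d" "act (- c) (- d)" i]
    by (simp add: algebra_simps)
qed simp

text \<open>Moving \<open>F\<close> past a translation is linear in the exponents: the matrix has
  rows \<open>(a, b)\<close> and \<open>(c, d)\<close>. For \<open>p0\<close> and \<open>p1\<close>
  it will be minus the identity, for \<open>\<rho>\<close> a matrix of order three.\<close>

lemma act_intertwine:
  assumes F: "\<And>x. F (f x) = act a b (F x)" and G: "\<And>x. F (g x) = act c d (F x)"
  shows "F (act m n x) = act (m * a + n * c) (m * b + n * d) (F x)"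
proof -
  have "F (act m n x) =
      iterate (act a b) (act (- a) (- b)) m (iterate (act c d) (act (- c) (- d)) n (F x))"
    unfolding act_def
    by (subst iterate_intertwine[of f f' "act a b" "act (- a) (- b)"],
        simp_all add: F act_def[symmetric],
        subst iterate_intertwine[of g g' "act c d" "act (- c) (- d)"], simp_all add: G)
  then show ?thesis by (simp add: iterate_act act_add)
qed

end

section \<open>Quotients of the square of the integers\<close>

lemma (in group) generate_pair_int_pow:
  assumes "a \<in> carrier G" "b \<in> carrier G"
  shows "a [^] (m::int) \<otimes> b [^] (n::int) \<in> generate G {a, b}"
proof -
  have "subgroup (generate G {a, b}) G"
    by (rule generate_is_subgroup) (use assms in auto)
  then show ?thesis
    by (meson generate.incl insertI1 insertI2 subgroup.m_closed subgroup_int_pow_closed)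
qed

text \<open>By \<open>cong\<close>, the fibre of \<open>q\<close> through the origin is a subgroup
  and all fibres are its cosets. The group is the quotient, with the values of \<open>q\<close>
  naming the cosets.\<close>

lemma int_pair_quotient_group:
  fixes q :: "int \<Rightarrow> int \<Rightarrow> 'a"
  assumes cong: "\<And>m n m' n' k l. q m n = q m' n' \<Longrightarrow> q (m + k) (n + l) = q (m' + k) (n' + l)"
  obtains \<Gamma> :: "'a monoid" where "comm_group \<Gamma>" "carrier \<Gamma> = {q m n | m n. True}"
    "\<And>m n m' n'. q m n \<otimes>\<^bsub>\<Gamma>\<^esub> q m' n' = q (m + m') (n + n')"
    "generate \<Gamma> {q 1 0, q 0 1} = carrier \<Gamma>"
proof -
  define Q where "Q = {q m n | m n. True}"
  have "\<forall>x\<in>Q. \<exists>p. x = q (fst p) (snd p)" unfolding Q_def by force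
  \<comment> \<open>\<open>c\<close> picks a representative pair for each value; \<open>cong\<close>
    makes the product independent of this choice.\<close>
  then obtain c where c: "\<And>x. x \<in> Q \<Longrightarrow> x = q (fst (c x)) (snd (c x))" by metis
  define \<Gamma> where "\<Gamma> = \<lparr>carrier = Q,
    monoid.mult = (\<lambda>x y. q (fst (c x) + fst (c y)) (snd (c x) + snd (c y))), one = q 0 0\<rparr>"
  have carr: "carrier \<Gamma> = {q m n | m n. True}" and one: "\<one>\<^bsub>\<Gamma>\<^esub> = q 0 0"
    by (simp_all add: \<Gamma>_def Q_def)
  have mult: "q m n \<otimes>\<^bsub>\<Gamma>\<^esub> q m' n' = q (m + m') (n + n')" for m n m' n'
  proof -
    let ?x = "c (q m n)" and ?y = "c (q m' n')"
    have x: "q (fst ?x) (snd ?x) = q m n" and y: "q (fst ?y) (snd ?y) = q m' n'"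
      using c[symmetric] by (auto simp: Q_def)
    show ?thesis
      using cong[OF x, of "fst ?y" "snd ?y"] cong[OF y, of m n] by (simp add: \<Gamma>_def add.commute)
  qed
  have "\<exists>y\<in>carrier \<Gamma>. y \<otimes>\<^bsub>\<Gamma>\<^esub> x = \<one>\<^bsub>\<Gamma>\<^esub>" if "x \<in> carrier \<Gamma>" for x
  proof -
    from that obtain m n where "x = q m n" by (auto simp: carr)
    then show ?thesis by (intro bexI[of _ "q (- m) (- n)"]) (auto simp: mult one carr)
  qed
  then have grp: "comm_group \<Gamma>"
    by (intro comm_groupI) (auto simp: carr mult one add_ac, (metis)+)
  interpret comm_group \<Gamma> by (rule grp)
  have q_in: "q m n \<in> carrier \<Gamma>" for m n by (auto simp: carr)
  have nat_pow: "q m n [^]\<^bsub>\<Gamma>\<^esub> (k::nat) = q (int k * m) (int k * n)" for m n k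
    by (induction k) (simp_all add: mult one algebra_simps)
  have inv: "inv\<^bsub>\<Gamma>\<^esub> (q m n) = q (- m) (- n)" for m n
    by (rule inv_equality) (simp_all add: mult one q_in)
  have int_pow: "q m n [^]\<^bsub>\<Gamma>\<^esub> (k::int) = q (k * m) (k * n)" for m n k
    by (cases k rule: int_cases2) (simp_all add: int_pow_int int_pow_neg_int nat_pow inv q_in)
  have "x \<in> generate \<Gamma> {q 1 0, q 0 1}" if "x \<in> carrier \<Gamma>" for x
  proof -
    from that obtain m n where "x = q m n" by (auto simp: carr)
    then show ?thesis
      using generate_pair_int_pow[OF q_in q_in, of 1 0 m 0 1 n] by (simp add: int_pow mult)
  qed
  moreover have "generate \<Gamma> {q 1 0, q 0 1} \<subseteq> carrier \<Gamma>"
    by (rule generate_incl) (auto simp: q_in)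
  ultimately have "generate \<Gamma> {q 1 0, q 0 1} = carrier \<Gamma>" by blast
  with that grp carr mult show thesis by blast
qed

section \<open>Translations and half-turns on darts\<close>

lemma less_3_cases: "i < (3::nat) \<Longrightarrow> i = 0 \<or> i = 1 \<or> i = 2"
  by auto

text \<open>Pairs of this form number the copies of each element, as the third component of a dart
  does in a Cayley sum graph. Equal values \<open>s i\<close> thus still give distinct
  edges.\<close>

lemma enumerate_three_element_multiset:
  fixes s :: "nat \<Rightarrow> 'a"
  obtains j :: "nat \<Rightarrow> nat"
  where "bij_betw (\<lambda>i. (s i, j i)) {..<3} {(x, k). k < count {#s 0, s 1, s 2#} x}"
proof -
  \<comment> \<open>\<open>j i\<close> counts the smaller indices with the same value of
    \<open>s\<close>.\<close>
  define j :: "nat \<Rightarrow> nat" where "j i = (if i = 0 then 0 else if i = 1 then of_bool (s 1 = s 0)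
    else of_bool (s 2 = s 0) + of_bool (s 2 = s 1))" for i
  have "bij_betw (\<lambda>i. (s i, j i)) {0, 1, 2} {(x, k). k < count {#s 0, s 1, s 2#} x}"
  proof (rule bij_betw_imageI)
    show "inj_on (\<lambda>i. (s i, j i)) {0, 1, 2}"
      by (auto simp: j_def)
    show "(\<lambda>i. (s i, j i)) ` {0, 1, 2} = {(x, k). k < count {#s 0, s 1, s 2#} x}"
      by (cases "s 1 = s 0"; cases "s 2 = s 0"; cases "s 2 = s 1")
        (auto simp: j_def less_Suc_eq split: if_splits)
  qed
  moreover have "{0, 1, 2} = {..<3::nat}" by auto
  ultimately show thesis using that by metis
qed

text \<open>The fullerene as a transitive action on darts. The equations hold on the whole type, so
  they rewrite without membership premises; \<open>transitive\<close> is connectedness, phrased as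
  minimality of \<open>D\<close> among closed sets.\<close>

locale dart_action =
  fixes D :: "'d set" and \<alpha> \<rho> :: "'d \<Rightarrow> 'd" and d\<^sub>0 :: 'd
  assumes finite_D: "finite D"
    and \<alpha>_closed: "d \<in> D \<Longrightarrow> \<alpha> d \<in> D" and \<rho>_closed: "d \<in> D \<Longrightarrow> \<rho> d \<in> D"
    and \<alpha>\<alpha> [simp]: "\<alpha> (\<alpha> d) = d" and \<rho>\<rho>\<rho> [simp]: "\<rho> (\<rho> (\<rho> d)) = d"
    and face_6: "\<rho> (\<alpha> (\<rho> (\<alpha> (\<rho> (\<alpha> (\<rho> (\<alpha> (\<rho> (\<alpha> (\<rho> (\<alpha> d))))))))))) = d"
    and \<rho>_no_fixpoint: "d \<in> D \<Longrightarrow> \<rho> d \<noteq> d"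
    and face_no_2: "d \<in> D \<Longrightarrow> \<rho> (\<alpha> (\<rho> (\<alpha> d))) \<noteq> d"
    and d\<^sub>0_in: "d\<^sub>0 \<in> D"
    and d\<^sub>0_fixed: "\<alpha> d\<^sub>0 = d\<^sub>0 \<or> \<rho> (\<alpha> (\<rho> (\<alpha> (\<rho> (\<alpha> d\<^sub>0))))) = d\<^sub>0"
    and transitive: "\<lbrakk>d\<^sub>0 \<in> U; \<And>d. d \<in> U \<Longrightarrow> \<alpha> d \<in> U; \<And>d. d \<in> U \<Longrightarrow> \<rho> d \<in> U\<rbrakk> \<Longrightarrow> D \<subseteq> U"
begin

section \<open>Half-turns and the lattice of translations\<close>

lemma \<rho>_eq_iff [simp]: "\<rho> x = \<rho> y \<longleftrightarrow> x = y"
  by (metis \<rho>\<rho>\<rho>)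

text \<open>\<open>p0\<close>, \<open>p1\<close>, \<open>p2\<close> are the half-turns about the midpoints of the three edges at a vertex.\<close>

definition p0 where "p0 d = \<alpha> d"
definition p1 where "p1 d = \<rho> (\<rho> (\<alpha> (\<rho> d)))"
definition p2 where "p2 d = \<rho> (\<alpha> (\<rho> (\<rho> d)))"

lemmas p_defs = p0_def p1_def p2_def

lemma pp [simp]: "p0 (p0 d) = d" "p1 (p1 d) = d" "p2 (p2 d) = d"
  by (simp_all add: p_defs)

text \<open>\<open>p2 p1 p0\<close> is the cube of \<open>\<rho> \<alpha>\<close>, and
  \<open>p0 p1 p2\<close> is its inverse. By \<open>face_6\<close> the cube is an involution, so the
  two agree.\<close>

lemma p012: "p0 (p1 (p2 d)) = p2 (p1 (p0 d))"
proof -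
  let ?F = "\<lambda>d. \<rho> (\<alpha> (\<rho> (\<alpha> (\<rho> (\<alpha> d)))))"
  have *: "p0 (p1 (p2 (?F e))) = e" and "p2 (p1 (p0 e)) = ?F e" for e
    by (simp_all add: p_defs)
  then show ?thesis
    using *[of "?F d"] by (simp add: face_6)
qed

sublocale commuting_bijections "\<lambda>d. p0 (p1 d)" "\<lambda>d. p1 (p0 d)" "\<lambda>d. p1 (p2 d)" "\<lambda>d. p2 (p1 d)"
proof
  show "p0 (p1 (p1 (p2 x))) = p1 (p2 (p0 (p1 x)))" for x
    \<comment> \<open>This instance collapses to \<open>p0 (p1 (p2 (p0 (p1 x)))) = p2 x\<close>, so
      both sides equal \<open>p0 (p2 x)\<close>.\<close>
    using p012[of "p0 (p1 x)"] by simp (metis pp)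
qed simp_all

lemma act_eqs:
  "p0 (p1 d) = act 1 0 d" "p1 (p0 d) = act (- 1) 0 d"
  "p1 (p2 d) = act 0 1 d" "p2 (p1 d) = act 0 (- 1) d"
  "p0 (p2 d) = act 1 1 d" "p2 (p0 d) = act (- 1) (- 1) d"
proof -
  show "p0 (p1 d) = act 1 0 d" "p1 (p0 d) = act (- 1) 0 d"
    "p1 (p2 d) = act 0 1 d" "p2 (p1 d) = act 0 (- 1) d" for d
    by (simp_all add: act_simps)
  then show "p0 (p2 d) = act 1 1 d" "p2 (p0 d) = act (- 1) (- 1) d"
    using act_add[of 1 0 0 1 d] act_add[of 0 "- 1" "- 1" 0 d]
    by (metis add.left_neutral add.right_neutral pp)+
qed

text \<open>It suffices to invert the two generators: for \<open>p0 p1\<close> this is immediate,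
  for \<open>p1 p2\<close> it is \<open>p012\<close>.\<close>

lemma p0_act: "p0 (act m n x) = act (- m) (- n) (p0 x)"
  using act_intertwine[of p0 "- 1" 0 0 "- 1" m n x] p012 by (simp add: act_simps)

lemma p1_act: "p1 (act m n x) = act (- m) (- n) (p1 x)"
  using act_intertwine[of p1 "- 1" 0 0 "- 1" m n x] by (simp add: act_simps)

lemma p2_act: "p2 (act m n x) = act (- m) (- n) (p2 x)"
proof -
  have "p2 (act m n x) = act 0 (- 1) (p1 (act m n x))" by (simp flip: act_eqs)
  also have "\<dots> = act (- m) (- n) (act 0 (- 1) (p1 x))"
    by (simp add: p1_act act_commute[of 0 "- 1"])
  finally show ?thesis by (simp flip: act_eqs)
qed

text \<open>Conjugation by \<open>\<rho>\<close> permutes the half-turns cyclically,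
  \<open>p0\<close> to \<open>p2\<close> to \<open>p1\<close> to \<open>p0\<close>. Hence
  \<open>p0 p1\<close> becomes \<open>p2 p0\<close>, and \<open>p1 p2\<close> becomes
  \<open>p0 p1\<close>.\<close>

lemma \<rho>_act: "\<rho> (act m n x) = act (n - m) (- m) (\<rho> x)"
proof -
  have "\<rho> (p0 (p1 x)) = act (- 1) (- 1) (\<rho> x)" "\<rho> (p1 (p2 x)) = act 1 0 (\<rho> x)" for x
    unfolding act_eqs[symmetric] by (simp_all add: p_defs)
  from act_intertwine[of \<rho>, OF this] show ?thesis by simp
qed

text \<open>The translation orbit that will contain exactly one dart at each vertex.\<close>

definition orb :: "'d set" where "orb = {act m n d\<^sub>0 | m n. True}"

lemma act_orb: "x \<in> orb \<Longrightarrow> act m n x \<in> orb"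
  by (force simp: orb_def simp flip: act_add)

lemma d\<^sub>0_orb: "d\<^sub>0 \<in> orb"
  unfolding orb_def by (rule CollectI) (metis act_0)

text \<open>The choice of \<open>d\<^sub>0\<close> enters here. A semiedge is fixed by
  \<open>p0\<close>; in a triangle \<open>p2 p1 p0\<close> fixes \<open>d\<^sub>0\<close>, so
  \<open>p0\<close> moves it as the translation \<open>p1 p2\<close> does.\<close>

lemma p0_d\<^sub>0: "p0 d\<^sub>0 \<in> orb"
  using d\<^sub>0_fixed
proof
  assume "\<alpha> d\<^sub>0 = d\<^sub>0"
  then show ?thesis using d\<^sub>0_orb by (simp add: p0_def)
next
  assume "\<rho> (\<alpha> (\<rho> (\<alpha> (\<rho> (\<alpha> d\<^sub>0))))) = d\<^sub>0"
  then have "p2 (p1 (p0 d\<^sub>0)) = d\<^sub>0" by (simp add: p_defs)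
  then have "p0 d\<^sub>0 = p1 (p2 d\<^sub>0)" by (metis pp)
  then show ?thesis using act_orb[OF d\<^sub>0_orb, of 0 1] by (simp flip: act_eqs)
qed

lemma p_d\<^sub>0: "p1 d\<^sub>0 \<in> orb" "p2 d\<^sub>0 \<in> orb"
proof -
  have "p1 (p0 (p0 d\<^sub>0)) \<in> orb" "p2 (p0 (p0 d\<^sub>0)) \<in> orb"
    using act_orb[OF p0_d\<^sub>0] by (simp_all only: act_eqs(2)[of "p0 d\<^sub>0"] act_eqs(6)[of "p0 d\<^sub>0"])
  then show "p1 d\<^sub>0 \<in> orb" "p2 d\<^sub>0 \<in> orb" by simp_all
qed

lemma p_orb: "x \<in> orb \<Longrightarrow> p0 x \<in> orb" "x \<in> orb \<Longrightarrow> p1 x \<in> orb" "x \<in> orb \<Longrightarrow> p2 x \<in> orb"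
  using p0_d\<^sub>0 p_d\<^sub>0 by (auto simp: orb_def p0_act p1_act p2_act) (metis act_add)+

section \<open>Decomposition of the darts into three copies of the translation orbit\<close>

definition p :: "nat \<Rightarrow> 'd \<Rightarrow> 'd" where
  "p i = (if i = 0 then p0 else if i = 1 then p1 else p2)"

lemma p_p [simp]: "p i (p i x) = x"
  and p_in_orb: "x \<in> orb \<Longrightarrow> p i x \<in> orb"
  and p_act: "p i (act m n x) = act (- m) (- n) (p i x)"
  by (simp_all add: p_def p_orb p0_act p1_act p2_act)

text \<open>Reversing a dart preserves its index \<open>i\<close>, so each edge has a well-defined
  index, which will select the element \<open>s i\<close> of the connection multiset.\<close>

lemma \<alpha>_\<rho>_power:
  assumes "i < 3"
  shows "\<alpha> ((\<rho> ^^ i) x) = (\<rho> ^^ i) (p i x)"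
  using less_3_cases[OF assms] by (auto simp: p_def p_defs numeral_2_eq_2)

text \<open>The union of the three images of \<open>orb\<close> is closed under
  \<open>\<alpha>\<close>, since \<open>orb\<close> is closed under each \<open>p i\<close>, and
  under \<open>\<rho>\<close>, since \<open>\<rho>\<close> has order three.\<close>

lemma D_decompose:
  assumes "d \<in> D"
  obtains i x where "i < 3" "x \<in> orb" "d = (\<rho> ^^ i) x"
proof -
  let ?U = "{(\<rho> ^^ i) x | i x. i < (3::nat) \<and> x \<in> orb}"
  have "D \<subseteq> ?U"
  proof (rule transitive)
    show "d\<^sub>0 \<in> ?U" using d\<^sub>0_orb by (force intro: exI[of _ 0])
    show "\<alpha> d \<in> ?U" if "d \<in> ?U" for d
      using that p_in_orb by (force simp: \<alpha>_\<rho>_power)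
    show "\<rho> d \<in> ?U" if d: "d \<in> ?U" for d
    proof -
      from d obtain i x where *: "i < 3" "x \<in> orb" "d = (\<rho> ^^ i) x" by blast
      then have "\<rho> d = (\<rho> ^^ (Suc i mod 3)) x"
        using less_3_cases[OF *(1)] by (auto simp: numeral_2_eq_2)
      then show ?thesis using * by (auto intro!: exI[of _ "Suc i mod 3"])
    qed
  qed
  with assms that show thesis by blast
qed

lemma orb_subset: "orb \<subseteq> D"
proof -
  have p: "p0 x \<in> D \<longleftrightarrow> x \<in> D" "p1 x \<in> D \<longleftrightarrow> x \<in> D" "p2 x \<in> D \<longleftrightarrow> x \<in> D" for x
    using \<alpha>_closed \<rho>_closed by (metis p_defs pp)+
  have "iterate f f' k x \<in> D" if "x \<in> D" "\<And>x. x \<in> D \<Longrightarrow> f x \<in> D" "\<And>x. x \<in> D \<Longrightarrow> f' x \<in> D"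
    for f f' k x
  proof -
    have "(h ^^ n) x \<in> D" if "\<And>x. x \<in> D \<Longrightarrow> h x \<in> D" for h n
      by (induction n) (use \<open>x \<in> D\<close> that in auto)
    with that show ?thesis by (auto simp: iterate_def)
  qed
  then show ?thesis by (auto simp: orb_def act_def p d\<^sub>0_in)
qed

text \<open>
  Otherwise \<open>\<rho>\<close> composed with some translation fixes a dart. Conjugating by translations, it
  becomes \<open>\<rho>\<close>, a conjugate of \<open>\<rho>\<close>, or the square of the inverse face permutation: the rotations
  of order three about a vertex or the centre of a face.
\<close>

lemma \<rho>_orb_disjoint:
  assumes "x \<in> orb"
  shows "\<rho> x \<notin> orb"
proof
  assume "\<rho> x \<in> orb"
  then obtain u v where uv: "\<rho> x = act u v x"
    using assms by (auto simp: orb_def) (metis act_add act_uminus(2) diff_add_cancel add.commute)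
  obtain m e where me: "u + v = 3 * m + e" and e: "e = 0 \<or> e = 1 \<or> e = -1"
  proof -
    \<comment> \<open>The remainder is shifted by one so that it lies in -1, 0, 1.\<close>
    have "u + v = 3 * ((u + v + 1) div 3) + ((u + v + 1) mod 3 - 1)" by presburger
    moreover have "(u + v + 1) mod 3 - 1 = 0 \<or> (u + v + 1) mod 3 - 1 = 1 \<or>
        (u + v + 1) mod 3 - 1 = -1" by presburger
    ultimately show thesis using that by blast
  qed
  \<comment> \<open>Replacing \<open>x\<close> by \<open>act a b x\<close> changes
    \<open>(u, v)\<close> to \<open>(u + b - 2 * a, v - a - b)\<close>, which preserves
    \<open>u + v\<close> modulo 3. The choice \<open>a = m\<close>, \<open>b = v - m\<close> leaves
    \<open>(e, 0)\<close>.\<close>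
  define y where "y = act m (v - m) x"
  have y: "\<rho> y = act e 0 y"
  proof -
    have "\<rho> y = act (v - 2 * m + u) (- m + v) x"
      by (simp only: y_def \<rho>_act uv flip: act_add) simp
    also have "\<dots> = act (e + m) (0 + (v - m)) x"
      using me by (simp add: algebra_simps)
    finally show ?thesis by (simp only: y_def act_add)
  qed
  have "y \<in> orb" using assms by (simp add: y_def act_orb)
  then have yD: "y \<in> D" using orb_subset by blast
  from e show False
  proof (elim disjE)
    assume "e = 0"
    then show False using y yD \<rho>_no_fixpoint by simp
  next
    assume "e = 1"
    then have "\<rho> y = \<alpha> (\<rho> (\<rho> (\<alpha> (\<rho> y))))"
      using y act_eqs(1)[of y] by (simp add: p_defs)
    then have "\<alpha> (\<rho> y) = \<rho> (\<rho> (\<alpha> (\<rho> y)))" by (metis \<alpha>\<alpha>)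
    then have "\<rho> (\<alpha> (\<rho> y)) = \<alpha> (\<rho> y)" by (metis \<rho>\<rho>\<rho>)
    then show False using \<rho>_no_fixpoint yD \<alpha>_closed \<rho>_closed by blast
  next
    assume "e = -1"
    then have "\<rho> y = \<rho> (\<rho> (\<alpha> (\<rho> (\<alpha> y))))"
      using y act_eqs(2)[of y] by (simp add: p_defs)
    then show False using face_no_2[OF yD] by simp
  qed
qed

lemma \<rho>_power_orb_unique:
  assumes "x \<in> orb" "y \<in> orb" "i < 3" "j < 3" "(\<rho> ^^ i) x = (\<rho> ^^ j) y"
  shows "i = j" "x = y"
proof -
  have "\<rho> (\<rho> z) \<notin> orb" if "z \<in> orb" for z
    using that \<rho>_orb_disjoint by (metis \<rho>\<rho>\<rho>)
  then show "i = j" "x = y"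
    using assms less_3_cases[OF \<open>i < 3\<close>] less_3_cases[OF \<open>j < 3\<close>] \<rho>_orb_disjoint
    by (auto simp: numeral_2_eq_2)
qed

lemma \<rho>_power_closed: "x \<in> D \<Longrightarrow> (\<rho> ^^ i) x \<in> D"
  by (induction i) (simp_all add: \<rho>_closed)

text \<open>\<open>h\<close> names the darts of \<open>orb\<close>, one per vertex, by natural
  numbers. The group is that of the translations modulo the stabilizer of \<open>d\<^sub>0\<close>,
  carried over to these names.\<close>

lemma cayley_sum_coordinates:
  obtains \<Gamma> :: "nat monoid" and S :: "nat multiset" and h :: "'d \<Rightarrow> nat"
    and g :: "'d \<Rightarrow> nat \<times> nat \<times> nat"
  where "comm_group \<Gamma>" "finite (carrier \<Gamma>)"
    "\<exists>a\<in>carrier \<Gamma>. \<exists>b\<in>carrier \<Gamma>. generate \<Gamma> {a, b} = carrier \<Gamma>"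
    "set_mset S \<subseteq> carrier \<Gamma>"
    "bij_betw h orb (carrier \<Gamma>)"
    "bij_betw g D (darts (cayley_sum_graph \<Gamma> S))"
    "\<And>i x. i < 3 \<Longrightarrow> x \<in> orb \<Longrightarrow> beg (cayley_sum_graph \<Gamma> S) (g ((\<rho> ^^ i) x)) = h x"
    "\<And>d. d \<in> D \<Longrightarrow> opp (cayley_sum_graph \<Gamma> S) (g d) = g (\<alpha> d)"
proof -
  have "finite orb" using finite_D orb_subset finite_subset by blast
  then obtain h :: "'d \<Rightarrow> nat" where h: "inj_on h orb"
    using finite_imp_inj_to_nat_seg by blast
  define q where "q m n = h (act m n d\<^sub>0)" for m n
  have act_in: "act m n d\<^sub>0 \<in> orb" for m n by (rule act_orb[OF d\<^sub>0_orb])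
  have cong: "q (m + k) (n + l) = q (m' + k) (n' + l)" if "q m n = q m' n'" for m n m' n' k l
  proof -
    from that have "act m n d\<^sub>0 = act m' n' d\<^sub>0"
      using inj_onD[OF h _ act_in act_in] by (simp add: q_def)
    then show ?thesis unfolding q_def by (metis act_add add.commute)
  qed
  obtain \<Gamma> :: "nat monoid" where \<Gamma>: "comm_group \<Gamma>" and carr: "carrier \<Gamma> = {q m n | m n. True}"
    and mult: "\<And>m n m' n'. q m n \<otimes>\<^bsub>\<Gamma>\<^esub> q m' n' = q (m + m') (n + n')"
    and gen: "generate \<Gamma> {q 1 0, q 0 1} = carrier \<Gamma>"
    using int_pair_quotient_group[of q, OF cong] by blast
  interpret comm_group \<Gamma> by (rule \<Gamma>)
  have carr_h: "carrier \<Gamma> = h ` orb"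
    by (auto simp: carr q_def orb_def)
  have bij_h: "bij_betw h orb (carrier \<Gamma>)"
    using h by (simp add: bij_betw_def carr_h)
  define s where "s i = h (p i d\<^sub>0)" for i
  \<comment> \<open>For \<open>x = t d\<^sub>0\<close> the half-turn gives
    \<open>p i x = t\<^sup>-\<^sup>1 (p i d\<^sub>0)\<close>, so \<open>t\<close> cancels in the
    product.\<close>
  have sum: "h x \<otimes>\<^bsub>\<Gamma>\<^esub> h (p i x) = s i" if "x \<in> orb" for x i
  proof -
    from that obtain m n where x: "x = act m n d\<^sub>0" by (auto simp: orb_def)
    from p_in_orb[OF d\<^sub>0_orb, of i] obtain k l where kl: "p i d\<^sub>0 = act k l d\<^sub>0" by (auto simp: orb_def)
    have "h x = q m n" "h (p i x) = q (- m + k) (- n + l)" "s i = q k l"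
      by (simp_all only: x q_def p_act kl s_def act_add)
    then show ?thesis by (simp add: mult)
  qed
  obtain j where j: "bij_betw (\<lambda>i. (s i, j i)) {..<3} {(x, k). k < count {#s 0, s 1, s 2#} x}"
    by (rule enumerate_three_element_multiset)
  define S where "S = {#s 0, s 1, s 2#}"
  have j_less: "j i < count S (s i)" if "i < 3" for i
    using bij_betwE[OF j] that by (auto simp: S_def)
  have "\<forall>d\<in>D. \<exists>i x. i < 3 \<and> x \<in> orb \<and> d = (\<rho> ^^ i) x"
    using D_decompose by metis
  then obtain I X where IX: "\<And>d. d \<in> D \<Longrightarrow> I d < 3" "\<And>d. d \<in> D \<Longrightarrow> X d \<in> orb"
    "\<And>d. d \<in> D \<Longrightarrow> d = (\<rho> ^^ I d) (X d)"
    by metis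
  have IX_eq: "I ((\<rho> ^^ i) x) = i" "X ((\<rho> ^^ i) x) = x" "(\<rho> ^^ i) x \<in> D" if "i < 3" "x \<in> orb" for i x
  proof -
    show D: "(\<rho> ^^ i) x \<in> D" using that orb_subset \<rho>_power_closed by blast
    show "I ((\<rho> ^^ i) x) = i" "X ((\<rho> ^^ i) x) = x"
      using \<rho>_power_orb_unique[OF IX(2)[OF D] that(2) IX(1)[OF D] that(1)] IX(3)[OF D] by simp_all
  qed
  \<comment> \<open>The components are the name of the start, the name of the end, and the copy
    number that separates parallel edges.\<close>
  define g where "g d = (h (X d), h (p (I d) (X d)), j (I d))" for d
  have darts_eq: "(u, v, k) \<in> darts (cayley_sum_graph \<Gamma> S) \<longleftrightarrow>
      u \<in> carrier \<Gamma> \<and> v \<in> carrier \<Gamma> \<and> k < count S (u \<otimes>\<^bsub>\<Gamma>\<^esub> v)" for u v k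
    by (simp add: cayley_sum_graph_def)
  have g_in: "g d \<in> darts (cayley_sum_graph \<Gamma> S)" if "d \<in> D" for d
    using IX[OF that] by (simp add: g_def darts_eq sum j_less carr_h p_in_orb)
  have "inj_on g D"
  proof (rule inj_onI)
    fix d e assume d: "d \<in> D" and e: "e \<in> D" and eq: "g d = g e"
    then have X: "X d = X e" using h IX(2) by (simp add: g_def inj_on_eq_iff)
    have "s (I d) = s (I e)"
      using eq sum[OF IX(2)[OF d], of "I d"] sum[OF IX(2)[OF e], of "I e"] by (simp add: g_def)
    then have "I d = I e"
      using eq j IX(1)[OF d] IX(1)[OF e] by (auto simp: g_def bij_betw_def inj_on_def)
    with X show "d = e" using IX(3) d e by metis
  qed
  moreover have "y \<in> g ` D" if "y \<in> darts (cayley_sum_graph \<Gamma> S)" for y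
  proof -
    obtain u v k where y: "y = (u, v, k)" by (cases y)
    with that have uv: "u \<in> carrier \<Gamma>" "v \<in> carrier \<Gamma>" and k: "k < count S (u \<otimes>\<^bsub>\<Gamma>\<^esub> v)"
      by (simp_all add: darts_eq)
    have "(u \<otimes>\<^bsub>\<Gamma>\<^esub> v, k) \<in> (\<lambda>i. (s i, j i)) ` {..<3}"
      using j k by (simp add: bij_betw_def S_def)
    then obtain i where i: "i < 3" "u \<otimes>\<^bsub>\<Gamma>\<^esub> v = s i" "k = j i" by auto
    from uv obtain x where x: "x \<in> orb" "u = h x" by (auto simp: carr_h)
    have "h (p i x) \<in> carrier \<Gamma>" using p_in_orb[OF x(1)] by (simp add: carr_h)
    moreover have "u \<otimes>\<^bsub>\<Gamma>\<^esub> h (p i x) = u \<otimes>\<^bsub>\<Gamma>\<^esub> v" using sum[OF x(1)] i x by simp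
    \<comment> \<open>Cancellation: the other end is determined by \<open>u\<close> and the
      product.\<close>
    ultimately have "v = h (p i x)" using uv by (metis Units_eq Units_l_cancel)
    then have "y = g ((\<rho> ^^ i) x)" using y x i by (simp add: g_def IX_eq)
    then show ?thesis using IX_eq(3)[OF i(1) x(1)] by blast
  qed
  ultimately have bij_g: "bij_betw g D (darts (cayley_sum_graph \<Gamma> S))"
    using g_in by (auto simp: bij_betw_def)
  show thesis
  proof (rule that[of \<Gamma> S h g, OF \<Gamma> _ _ _ bij_h bij_g])
    show "finite (carrier \<Gamma>)" using \<open>finite orb\<close> by (simp add: carr_h)
    show "\<exists>a\<in>carrier \<Gamma>. \<exists>b\<in>carrier \<Gamma>. generate \<Gamma> {a, b} = carrier \<Gamma>"
      using gen by (auto simp: carr)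
    show "set_mset S \<subseteq> carrier \<Gamma>"
      by (auto simp: S_def s_def carr_h p_in_orb d\<^sub>0_orb)
    show "beg (cayley_sum_graph \<Gamma> S) (g ((\<rho> ^^ i) x)) = h x" if "i < 3" "x \<in> orb" for i x
      using that by (simp add: g_def IX_eq cayley_sum_graph_def)
    show "opp (cayley_sum_graph \<Gamma> S) (g d) = g (\<alpha> d)" if "d \<in> D" for d
    proof -
      from that obtain i x where "i < 3" "x \<in> orb" "d = (\<rho> ^^ i) x" by (rule D_decompose)
      then show ?thesis
        by (simp add: \<alpha>_\<rho>_power g_def IX_eq p_in_orb cayley_sum_graph_def)
    qed
  qed
qed

end

section \<open>Orbits and Euler's formula\<close>

lemma
  assumes "permutation f"
  shows funpow_card_orbit: "(f ^^ card (orbit f x)) x = x"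
    and card_orbit_le: "0 < k \<Longrightarrow> (f ^^ k) x = x \<Longrightarrow> card (orbit f x) \<le> k"
    and orbit_eq_image_funpow: "orbit f x = (\<lambda>n. (f ^^ n) x) ` {..<card (orbit f x)}"
proof -
  have x: "x \<in> orbit f x" using assms by (rule permutation_self_in_orbit)
  have card: "card (orbit f x) = funpow_dist1 f x x"
    unfolding orbit_conv_funpow_dist1[OF x]
    by (subst card_image[OF inj_on_funpow_dist1[OF x]]) simp
  show "(f ^^ card (orbit f x)) x = x"
    unfolding card by (rule funpow_dist1_prop[OF x])
  show "orbit f x = (\<lambda>n. (f ^^ n) x) ` {..<card (orbit f x)}"
    unfolding card using orbit_conv_funpow_dist1[OF x] by (simp only: atLeast0LessThan)
  assume "0 < k" "(f ^^ k) x = x"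
  then have "orbit f x = (\<lambda>n. (f ^^ n) x) ` {..<k}"
    by (subst orbit_altdef_bounded[of k f x]) auto
  then show "card (orbit f x) \<le> k"
    by (metis card_image_le card_lessThan finite_lessThan)
qed

lemma card_darts_cubic:
  assumes "sgraph G" "cubic G"
  shows "card (darts G) = 3 * card (verts G)"
proof -
  have "darts G = (\<Union>v\<in>verts G. darts_at G v)"
    using assms by (auto simp: sgraph_def darts_at_def)
  also have "card \<dots> = (\<Sum>v\<in>verts G. card (darts_at G v))"
    using assms by (intro card_UN_disjoint) (auto simp: sgraph_def darts_at_def)
  finally show ?thesis using assms by (simp add: cubic_def)
qed

lemma card_proper_edges_no_semiedges:
  assumes "sgraph G" "\<And>d. d \<in> darts G \<Longrightarrow> opp G d \<noteq> d"
  shows "2 * card (proper_edges G) = card (darts G)"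
proof -
  have opp_in: "opp G d \<in> darts G" and opp_opp: "opp G (opp G d) = d" if "d \<in> darts G" for d
    using assms(1) that by (auto simp: sgraph_def)
  have U: "\<Union> (proper_edges G) = darts G"
    using assms(2) opp_in by (auto simp: proper_edges_def)
  have "2 * card (proper_edges G) = card (\<Union> (proper_edges G))"
  proof (rule card_partition)
    show "finite (\<Union> (proper_edges G))" using U assms by (simp add: sgraph_def)
    then show "finite (proper_edges G)" by (rule finite_UnionD)
    show "card c = 2" if "c \<in> proper_edges G" for c
      using that by (auto simp: proper_edges_def card_2_iff)
    show "c \<inter> c' = {}" if "c \<in> proper_edges G" "c' \<in> proper_edges G" "c \<noteq> c'" for c c'
    proof -
      from that obtain d e where d: "d \<in> darts G" "c = {d, opp G d}"
        and e: "e \<in> darts G" "c' = {e, opp G e}"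
        by (auto simp: proper_edges_def)
      have "c = c'" if "e = d \<or> e = opp G d \<or> opp G e = d \<or> opp G e = opp G d"
        using that d(2) e(2) opp_opp[OF d(1)] opp_opp[OF e(1)] by (metis insert_commute)
      with that(3) have "e \<noteq> d" "e \<noteq> opp G d" "opp G e \<noteq> d" "opp G e \<noteq> opp G d" by blast+
      then show ?thesis unfolding d(2) e(2) by auto
    qed
  qed
  then show ?thesis by (simp add: U)
qed

text \<open>The permutation \<open>\<phi>\<close> stands in for the map used in
  \<open>faces\<close>, whose values outside the darts are unconstrained.\<close>

lemma card_faces_uniform:
  assumes "finite (darts G)" and perm: "\<phi> permutes darts G"
    and faces: "faces G rot = orbit \<phi> ` darts G"
    and k: "\<And>F. F \<in> faces G rot \<Longrightarrow> card F = k"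
  shows "k * card (faces G rot) = card (darts G)"
proof -
  have p: "permutation \<phi>" using assms permutation_permutes by blast
  have U: "\<Union> (faces G rot) = darts G"
    using permutation_self_in_orbit[OF p] permutes_orbit_subset[OF perm] by (auto simp: faces)
  have "k * card (faces G rot) = card (\<Union> (faces G rot))"
  proof (rule card_partition)
    show "finite (faces G rot)" using assms by (simp add: faces)
    show "finite (\<Union> (faces G rot))" using assms(1) by (simp only: U)
    show "c \<inter> c' = {}" if "c \<in> faces G rot" "c' \<in> faces G rot" "c \<noteq> c'" for c c'
    proof (rule ccontr)
      assume "c \<inter> c' \<noteq> {}"
      then obtain x where "x \<in> c" "x \<in> c'" by blast
      moreover have "cyclic_on \<phi> c" "cyclic_on \<phi> c'"
        using that p by (auto simp: faces intro: cyclic_on_orbit')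
      ultimately show False using \<open>c \<noteq> c'\<close> orbit_cyclic_eq3 by metis
    qed
  qed (rule k)
  then show ?thesis by (simp add: U)
qed

section \<open>Fullerenes\<close>

context
  fixes G :: "('v, 'd) sgraph" and rot :: "'d \<Rightarrow> 'd"
  assumes fullerene: "fullerene_036 G rot"
begin

lemma sgraph_G: "sgraph G" and connected_G: "connected_sgraph G"
  and rotation_G: "rotation_system G rot" and cubic_G: "cubic G"
  and euler_G: "int (card (verts G)) - int (card (proper_edges G)) + int (card (faces G rot)) = 2"
  and face_size: "F \<in> faces G rot \<Longrightarrow> card F = 3 \<or> card F = 6"
  using fullerene by (auto simp: fullerene_036_def plane_sgraph_def)

lemma finite_darts: "finite (darts G)"
  and beg_in: "d \<in> darts G \<Longrightarrow> beg G d \<in> verts G"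
  and opp_in: "d \<in> darts G \<Longrightarrow> opp G d \<in> darts G"
  and opp_opp: "d \<in> darts G \<Longrightarrow> opp G (opp G d) = d"
  using sgraph_G by (auto simp: sgraph_def)

lemma rot_permutes: "rot permutes darts G"
  and rot_cyclic: "v \<in> verts G \<Longrightarrow> cyclic_on rot (darts_at G v)"
  using rotation_G by (auto simp: rotation_system_def)

text \<open>Extending \<open>opp\<close> by the identity gives an involution of the whole type, as
  \<open>dart_action\<close> requires.\<close>

definition flip :: "'d \<Rightarrow> 'd" where "flip d = (if d \<in> darts G then opp G d else d)"

lemma flip_flip: "flip (flip d) = d" and flip_in: "d \<in> darts G \<Longrightarrow> flip d \<in> darts G"
  by (auto simp: flip_def opp_in opp_opp)

lemma flip_permutes: "flip permutes darts G"
  unfolding permutes_def using flip_flip by (metis flip_def)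

lemma permutation_rot: "permutation rot"
  using rot_permutes finite_darts permutation_permutes by blast

lemma rot_in: "d \<in> darts G \<Longrightarrow> rot d \<in> darts G"
  using rot_permutes by (simp add: permutes_in_image)

lemma darts_at_eq_orbit:
  assumes "d \<in> darts G"
  shows "darts_at G (beg G d) = orbit rot d"
  using rot_cyclic[OF beg_in[OF assms]] assms
  by (intro orbit_cyclic_eq3[symmetric]) (auto simp: darts_at_def)

lemma card_orbit_rot:
  assumes "d \<in> darts G"
  shows "card (orbit rot d) = 3"
  using darts_at_eq_orbit[OF assms] cubic_G beg_in[OF assms] by (metis cubic_def)

lemma rot_rot_rot: "rot (rot (rot d)) = d"
proof (cases "d \<in> darts G")
  case True
  then show ?thesis
    using funpow_card_orbit[OF permutation_rot, of d]
    by (simp add: card_orbit_rot numeral_3_eq_3)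
next
  case False
  then show ?thesis using rot_permutes by (simp add: permutes_not_in)
qed

lemma rot_neq: "d \<in> darts G \<Longrightarrow> rot d \<noteq> d"
  using card_orbit_le[OF permutation_rot, of 1 d] card_orbit_rot[of d] by auto

lemma beg_rot: "d \<in> darts G \<Longrightarrow> beg G (rot d) = beg G d"
  using darts_at_eq_orbit orbit.base by (fastforce simp: darts_at_def)

lemma darts_at_cases:
  assumes "d \<in> darts G" "e \<in> darts G" "beg G e = beg G d"
  obtains i where "i < 3" "e = (rot ^^ i) d"
proof -
  have "e \<in> orbit rot d" using assms darts_at_eq_orbit by (auto simp: darts_at_def)
  then show thesis
    using orbit_eq_image_funpow[OF permutation_rot, of d] card_orbit_rot[OF assms(1)] that by auto
qed

definition face :: "'d \<Rightarrow> 'd" where "face d = rot (flip d)"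

lemma face_permutes: "face permutes darts G"
  unfolding face_def using permutes_compose[OF flip_permutes rot_permutes] by (simp add: comp_def)

lemma permutation_face: "permutation face"
  using face_permutes finite_darts permutation_permutes by blast

lemma faces_eq: "faces G rot = orbit face ` darts G"
proof -
  have "orbit (\<lambda>e. rot (opp G e)) d = orbit face d" if "d \<in> darts G" for d
    by (rule orbit_cong0[OF that])
      (auto simp: face_def flip_def rot_in opp_in)
  then show ?thesis by (auto simp: faces_def)
qed

lemma card_orbit_face: "d \<in> darts G \<Longrightarrow> card (orbit face d) = 3 \<or> card (orbit face d) = 6"
  by (rule face_size) (simp add: faces_eq)

text \<open>Both face sizes divide 6, and other elements of the type are fixed.\<close>

lemma face_power_6: "(face ^^ 6) d = d"
proof (cases "d \<in> darts G")
  case True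
  have "(face ^^ (3 + 3)) d = d" if "(face ^^ 3) d = d"
    using that unfolding funpow_add by simp
  then show ?thesis
    using card_orbit_face[OF True] funpow_card_orbit[OF permutation_face, of d] by auto
next
  case False
  then have "face d = d" using face_permutes by (simp add: permutes_not_in)
  then have "(face ^^ n) d = d" for n by (induction n) auto
  then show ?thesis .
qed

lemma face_power_2: "d \<in> darts G \<Longrightarrow> (face ^^ 2) d \<noteq> d"
  using card_orbit_le[OF permutation_face, of 2 d] card_orbit_face[of d] by auto

text \<open>Otherwise there are no semiedges and all faces are hexagons. With \<open>V\<close>
  vertices there are then \<open>3V/2\<close> edges and \<open>V/2\<close> faces, so the Euler
  characteristic would be 0 instead of 2.\<close>

lemma obtain_half_turn:
  obtains d where "d \<in> darts G" "flip d = d \<or> (face ^^ 3) d = d"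
proof -
  have "\<exists>d\<in>darts G. flip d = d \<or> (face ^^ 3) d = d"
  proof (rule ccontr)
    assume *: "\<not> ?thesis"
    then have "opp G d \<noteq> d" if "d \<in> darts G" for d using that by (auto simp: flip_def)
    then have "2 * card (proper_edges G) = 3 * card (verts G)"
      using card_proper_edges_no_semiedges[OF sgraph_G] card_darts_cubic[OF sgraph_G cubic_G]
      by simp
    moreover have "card F = 6" if "F \<in> faces G rot" for F
      using that face_size * funpow_card_orbit[OF permutation_face] by (metis faces_eq imageE)
    then have "6 * card (faces G rot) = 3 * card (verts G)"
      using card_faces_uniform[OF finite_darts face_permutes faces_eq]
        card_darts_cubic[OF sgraph_G cubic_G] by simp
    ultimately show False using euler_G by linarith
  qed
  with that show thesis by blast
qed

text \<open>Connectedness passes from vertices to darts: closure under \<open>rot\<close> spreads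
  \<open>U\<close> over all darts at a vertex, and closure under \<open>flip\<close> carries it
  along an edge.\<close>

lemma darts_connected:
  assumes "d \<in> darts G" "d \<in> U" "\<And>d. d \<in> U \<Longrightarrow> flip d \<in> U" "\<And>d. d \<in> U \<Longrightarrow> rot d \<in> U"
  shows "darts G \<subseteq> U"
proof
  fix e assume e: "e \<in> darts G"
  have star: "e \<in> U" if x: "x \<in> U" "x \<in> darts G" "e \<in> darts G" "beg G e = beg G x" for x e
  proof -
    obtain i where i: "e = (rot ^^ i) x"
      using darts_at_cases[OF x(2-4)] by blast
    have "(rot ^^ i) x \<in> U" by (induction i) (simp_all add: x(1) assms(4))
    with i show ?thesis by simp
  qed
  have "(beg G d, beg G e) \<in> (adjacency G)\<^sup>*"
    using connected_G beg_in assms(1) e by (simp add: connected_sgraph_def)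
  then have "\<exists>x\<in>U \<inter> darts G. beg G x = beg G e"
  proof induction
    case base
    then show ?case using assms by blast
  next
    case (step u v)
    then obtain x y where x: "x \<in> U" "x \<in> darts G" "beg G x = u"
      and y: "y \<in> darts G" "u = beg G y" "v = beg G (opp G y)"
      by (auto simp: adjacency_def)
    then have "y \<in> U" using star by metis
    then have "opp G y \<in> U" using assms(3)[of y] y by (simp add: flip_def)
    then show ?case using y opp_in by auto
  qed
  then show "e \<in> U" using star e by (metis IntD1 IntD2)
qed

lemma fullerene_iso_cayley_sum_graph:
  "\<exists>(\<Gamma> :: nat monoid) (S :: nat multiset).
     comm_group \<Gamma> \<and> finite (carrier \<Gamma>) \<and>
     (\<exists>a\<in>carrier \<Gamma>. \<exists>b\<in>carrier \<Gamma>. generate \<Gamma> {a, b} = carrier \<Gamma>) \<and>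
     set_mset S \<subseteq> carrier \<Gamma> \<and>
     sgraph_iso G (cayley_sum_graph \<Gamma> S)"
proof -
  obtain d\<^sub>0 where d\<^sub>0: "d\<^sub>0 \<in> darts G" "flip d\<^sub>0 = d\<^sub>0 \<or> (face ^^ 3) d\<^sub>0 = d\<^sub>0"
    by (rule obtain_half_turn)
  interpret dart_action "darts G" flip rot d\<^sub>0
  proof
    show "rot (flip (rot (flip (rot (flip (rot (flip (rot (flip (rot (flip d))))))))))) = d" for d
      using face_power_6[of d] by (simp add: face_def eval_nat_numeral)
    show "rot (flip (rot (flip d))) \<noteq> d" if "d \<in> darts G" for d
      using face_power_2[OF that] by (simp add: face_def eval_nat_numeral)
    show "flip d\<^sub>0 = d\<^sub>0 \<or> rot (flip (rot (flip (rot (flip d\<^sub>0))))) = d\<^sub>0"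
      using d\<^sub>0(2) by (simp add: face_def eval_nat_numeral)
    show "darts G \<subseteq> U"
      if "d\<^sub>0 \<in> U" "\<And>d. d \<in> U \<Longrightarrow> flip d \<in> U" "\<And>d. d \<in> U \<Longrightarrow> rot d \<in> U" for U
      using darts_connected[OF d\<^sub>0(1)] that by blast
  qed (simp_all add: d\<^sub>0(1) finite_darts flip_in rot_in flip_flip rot_rot_rot rot_neq)
  obtain \<Gamma> :: "nat monoid" and S h g where \<Gamma>: "comm_group \<Gamma>" "finite (carrier \<Gamma>)"
    "\<exists>a\<in>carrier \<Gamma>. \<exists>b\<in>carrier \<Gamma>. generate \<Gamma> {a, b} = carrier \<Gamma>" "set_mset S \<subseteq> carrier \<Gamma>"
    and h: "bij_betw h orb (carrier \<Gamma>)"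
    and g: "bij_betw g (darts G) (darts (cayley_sum_graph \<Gamma> S))"
    and beg_g: "\<And>i x. i < 3 \<Longrightarrow> x \<in> orb \<Longrightarrow> beg (cayley_sum_graph \<Gamma> S) (g ((rot ^^ i) x)) = h x"
    and opp_g: "\<And>d. d \<in> darts G \<Longrightarrow> opp (cayley_sum_graph \<Gamma> S) (g d) = g (flip d)"
    by (rule cayley_sum_coordinates) blast
  have beg_power: "beg G ((rot ^^ i) x) = beg G x" if "x \<in> darts G" for i x
    by (induction i) (simp_all add: that beg_rot \<rho>_power_closed)
  \<comment> \<open>Darts at one vertex differ by a power of \<open>rot\<close>, and distinct powers
    send \<open>orb\<close> to disjoint sets.\<close>
  have inj: "inj_on (beg G) orb"
  proof (rule inj_onI)
    fix x y assume xy: "x \<in> orb" "y \<in> orb" "beg G x = beg G y"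
    then obtain i where "i < 3" "x = (rot ^^ i) y"
      using darts_at_cases[of y x] orb_subset by auto
    then show "x = y" using \<rho>_power_orb_unique[of x y 0 i] xy by simp
  qed
  have "v \<in> beg G ` orb" if "v \<in> verts G" for v
  proof -
    have "darts_at G v \<noteq> {}" using cubic_G that by (force simp: cubic_def)
    then obtain d where d: "d \<in> darts G" "beg G d = v" by (auto simp: darts_at_def)
    then obtain i x where "x \<in> orb" "d = (rot ^^ i) x" using D_decompose by metis
    then show ?thesis using d beg_power orb_subset by auto
  qed
  then have bij_beg: "bij_betw (beg G) orb (verts G)"
    using inj orb_subset beg_in by (auto simp: bij_betw_def)
  \<comment> \<open>\<open>f v\<close> is the name of the unique dart of \<open>orb\<close> at
    \<open>v\<close>.\<close>
  define f where "f v = h (inv_into orb (beg G) v)" for v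
  have f_beg: "f (beg G x) = h x" if "x \<in> orb" for x
    using inj that by (simp add: f_def)
  have f: "bij_betw f (verts G) (verts (cayley_sum_graph \<Gamma> S))"
    using bij_betw_trans[OF bij_betw_inv_into[OF bij_beg] h]
    by (simp add: f_def[abs_def] comp_def cayley_sum_graph_def)
  have "beg (cayley_sum_graph \<Gamma> S) (g d) = f (beg G d)" if d: "d \<in> darts G" for d
  proof -
    obtain i x where ix: "i < 3" "x \<in> orb" "d = (rot ^^ i) x" using d by (rule D_decompose)
    then have "beg G d = beg G x" using beg_power orb_subset by auto
    then show ?thesis using ix beg_g f_beg by simp
  qed
  then have "sgraph_iso G (cayley_sum_graph \<Gamma> S)"
    unfolding sgraph_iso_def using f g opp_g by (metis flip_def)
  with \<Gamma> show ?thesis by blast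
qed

end

theorem theorem3:
  fixes G :: "('v, 'd) sgraph" and rot :: "'d \<Rightarrow> 'd"
  assumes "fullerene_036 G rot"
  shows "\<exists>(\<Gamma> :: nat monoid) (S :: nat multiset).
           comm_group \<Gamma> \<and> finite (carrier \<Gamma>) \<and>
           (\<exists>a\<in>carrier \<Gamma>. \<exists>b\<in>carrier \<Gamma>. generate \<Gamma> {a, b} = carrier \<Gamma>) \<and>
           set_mset S \<subseteq> carrier \<Gamma> \<and>
           sgraph_iso G (cayley_sum_graph \<Gamma> S)"
  using assms by (rule fullerene_iso_cayley_sum_graph)

end
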